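(* Any PAJ $A$ is flexible, i.e. $(xy)x=x(yx)$ for all $x,y\in A$.
   Context: Algebras are not necessarily associative, commutative or unital. $\mathbb F$ is a field of characteristic $\ne 2$ and $A$ is an $\mathbb F$-algebra. For an idempotent $a\in A$ put $A_0(a)=\{y\in A: ay=ya=0\}$ and $A_{\lambda,\delta}(a)=\{y\in A: ay=\lambda y,\ ya=\delta y\}$. For $\lambda,\delta\in\mathbb F\setminus\{0,1\}$, a primitive axis of type $(\lambda,\delta)$ is a nonzero idempotent $a\in A$ with $\{y:ay=y\}=\mathbb Fa=\{y:ya=y\}$, such that $A=\mathbb Fa\oplus A_0(a)\oplus A_{\lambda,\delta}(a)$ and this is a $\mathbb Z_2$-grading with even part $\mathbb Fa\oplus A_0(a)$ and odd part $A_{\lambda,\delta}(a)$. A PAJ is an algebra generated by a set of primitive axes (possibly of different types). *)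

theory Defs
  imports Complex_Main
begin

text \<open>
  The algebra is the whole type \<open>'a\<close>. Its product is only assumed to be bilinear:
  neither associative, nor commutative, nor unital.
\<close>

locale nonassoc_algebra = vector_space scale
  for scale :: "'f::field \<Rightarrow> 'a::ab_group_add \<Rightarrow> 'a"  (infixr \<open>*s\<close> 75) +
  fixes mult :: "'a \<Rightarrow> 'a \<Rightarrow> 'a"  (infixl \<open>\<cdot>\<close> 70)
  assumes linear_mult_left: "Vector_Spaces.linear scale scale (\<lambda>y. x \<cdot> y)"
    and linear_mult_right: "Vector_Spaces.linear scale scale (\<lambda>x. x \<cdot> y)"
begin

definition subalgebra :: "'a set \<Rightarrow> bool" where
  "subalgebra S \<longleftrightarrow> subspace S \<and> (\<forall>x\<in>S. \<forall>y\<in>S. x \<cdot> y \<in> S)"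

definition left_eigenspace :: "'a \<Rightarrow> 'f \<Rightarrow> 'a set" where
  "left_eigenspace a l = {y. a \<cdot> y = l *s y}"

definition right_eigenspace :: "'a \<Rightarrow> 'f \<Rightarrow> 'a set" where
  "right_eigenspace a d = {y. y \<cdot> a = d *s y}"

definition null_space :: "'a \<Rightarrow> 'a set" where
  "null_space a = {y. a \<cdot> y = 0 \<and> y \<cdot> a = 0}"

definition eigenspace :: "'a \<Rightarrow> 'f \<Rightarrow> 'f \<Rightarrow> 'a set" where
  "eigenspace a l d = {y. a \<cdot> y = l *s y \<and> y \<cdot> a = d *s y}"

definition direct_sum3 :: "'a set \<Rightarrow> 'a set \<Rightarrow> 'a set \<Rightarrow> bool" where
  "direct_sum3 U V W \<longleftrightarrow>
     (\<forall>y. \<exists>!(u, v, w). u \<in> U \<and> v \<in> V \<and> w \<in> W \<and> y = u + v + w)"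

text \<open>
  Only the multiplicative part of a grading by the integers modulo 2: that the algebra is the
  direct sum of the even part \<open>E\<close> and the odd part \<open>D\<close> has to be required in addition.
\<close>

definition z2_graded_mult :: "'a set \<Rightarrow> 'a set \<Rightarrow> bool" where
  "z2_graded_mult E D \<longleftrightarrow>
     (\<forall>x\<in>E. \<forall>y\<in>E. x \<cdot> y \<in> E) \<and>
     (\<forall>x\<in>E. \<forall>y\<in>D. x \<cdot> y \<in> D) \<and>
     (\<forall>x\<in>D. \<forall>y\<in>E. x \<cdot> y \<in> D) \<and>
     (\<forall>x\<in>D. \<forall>y\<in>D. x \<cdot> y \<in> E)"

definition primitive_axis :: "'f \<Rightarrow> 'f \<Rightarrow> 'a \<Rightarrow> bool" where
  "primitive_axis l d a \<longleftrightarrow>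
     l \<notin> {0, 1} \<and> d \<notin> {0, 1} \<and>
     a \<noteq> 0 \<and> a \<cdot> a = a \<and>
     left_eigenspace a 1 = span {a} \<and> right_eigenspace a 1 = span {a} \<and>
     direct_sum3 (span {a}) (null_space a) (eigenspace a l d) \<and>
     z2_graded_mult {u + v |u v. u \<in> span {a} \<and> v \<in> null_space a} (eigenspace a l d)"

end

locale paj = nonassoc_algebra +
  assumes generated_by_axes:
    "\<exists>X. (\<forall>a\<in>X. \<exists>l d. primitive_axis l d a) \<and> subalgebra hull X = UNIV"

end

theory Submission
  imports Defs
begin

text \<open>
  Every axis \<open>a\<close> yields an automorphism, minus the identity on its odd part, which maps axes to
  axes; since the characteristic is not 2, the algebra is therefore spanned by axes, and it suffices
  to prove the linearized identity \<open>(x, y, z) + (z, y, x) = 0\<close> for the associator when \<open>x\<close> and \<open>z\<close>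
  are axes. It is trivial when both commute with everything. If \<open>a\<close> does not commute with everything,
  the two-generated subalgebras show that the odd part of \<open>a\<close> is spanned by the vectors \<open>w\<close> for
  which \<open>a + w\<close> is an axis of the same type. Comparing these shifted axes with each other and with
  the remaining axes gives that odd vectors multiply to 0, that \<open>l + d = 1\<close> unless the odd part
  is 0, that \<open>l (u v) = d (v u)\<close> for \<open>u\<close> in the null space and \<open>v\<close> odd, and that the component of
  \<open>u u' - u' u\<close> along \<open>a\<close> vanishes for null vectors. The identity follows by expanding
  into components.
\<close>

context nonassoc_algebra
begin

section \<open>Bilinearity of the product\<close>

lemma mult_add_left [simp]: "(x + y) \<cdot> z = x \<cdot> z + y \<cdot> z"
  using linear_mult_right[of z] by (simp add: Vector_Spaces.linear_iff)

lemma mult_add_right [simp]: "x \<cdot> (y + z) = x \<cdot> y + x \<cdot> z"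
  using linear_mult_left[of x] by (simp add: Vector_Spaces.linear_iff)

lemma mult_scale_left [simp]: "(c *s x) \<cdot> y = c *s (x \<cdot> y)"
  using linear_mult_right[of y] by (simp add: Vector_Spaces.linear_iff)

lemma mult_scale_right [simp]: "x \<cdot> (c *s y) = c *s (x \<cdot> y)"
  using linear_mult_left[of x] by (simp add: Vector_Spaces.linear_iff)

lemma mult_zero_left [simp]: "0 \<cdot> x = 0"
  using mult_scale_left[of 0 0 x] by simp

lemma mult_zero_right [simp]: "x \<cdot> 0 = 0"
  using mult_scale_right[of x 0 0] by simp

lemma mult_minus_left [simp]: "(- x) \<cdot> y = - (x \<cdot> y)"
  using mult_scale_left[of "-1" x y] by simp

lemma mult_minus_right [simp]: "x \<cdot> (- y) = - (x \<cdot> y)"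
  using mult_scale_right[of x "-1" y] by simp

lemma mult_diff_left [simp]: "(x - y) \<cdot> z = x \<cdot> z - y \<cdot> z"
  using mult_add_left[of x "- y" z] by simp

lemma mult_diff_right [simp]: "x \<cdot> (y - z) = x \<cdot> y - x \<cdot> z"
  using mult_add_right[of x y "- z"] by simp

lemma subspace_null_space: "subspace (null_space a)"
  by (auto simp: subspace_def null_space_def)

lemma subspace_eigenspace: "subspace (eigenspace a l d)"
  by (auto simp: subspace_def eigenspace_def scale_right_distrib scale_left_commute)

section \<open>The decomposition along a single axis\<close>

definition even_space :: "'a \<Rightarrow> 'a set" where
  "even_space a = {u + v |u v. u \<in> span {a} \<and> v \<in> null_space a}"

text \<open>Primitivity and uniqueness of the decomposition are not required because they follow from
  \<open>l \<notin> {0, 1}\<close> and \<open>d \<notin> {0, 1}\<close>.\<close>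

definition axis :: "'f \<Rightarrow> 'f \<Rightarrow> 'a \<Rightarrow> bool" where
  "axis l d a \<longleftrightarrow> l \<notin> {0, 1} \<and> d \<notin> {0, 1} \<and> a \<noteq> 0 \<and> a \<cdot> a = a \<and>
     (\<forall>y. \<exists>p u v. y = p *s a + u + v \<and> u \<in> null_space a \<and> v \<in> eigenspace a l d) \<and>
     z2_graded_mult (even_space a) (eigenspace a l d)"

lemma even_space_iff: "x \<in> even_space a \<longleftrightarrow> (\<exists>p u. x = p *s a + u \<and> u \<in> null_space a)"
  by (auto simp: even_space_def span_singleton)

lemma primitive_axis_imp_axis:
  assumes "primitive_axis l d a"
  shows "axis l d a"
proof -
  have "\<exists>p u v. y = p *s a + u + v \<and> u \<in> null_space a \<and> v \<in> eigenspace a l d" for y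
  proof -
    have "\<exists>!(u, v, w). u \<in> span {a} \<and> v \<in> null_space a \<and> w \<in> eigenspace a l d \<and> y = u + v + w"
      using assms by (auto simp: primitive_axis_def direct_sum3_def)
    then obtain u v w where "u \<in> span {a}" "v \<in> null_space a" "w \<in> eigenspace a l d" "y = u + v + w"
      by auto
    then show ?thesis by (auto simp: span_singleton)
  qed
  then show ?thesis using assms by (auto simp: primitive_axis_def axis_def even_space_def)
qed

text \<open>The choice is determined when \<open>axis l d a\<close> holds, by
  \<open>axis_unique\<close>; for other arguments the value is arbitrary.\<close>

definition coef :: "'f \<Rightarrow> 'f \<Rightarrow> 'a \<Rightarrow> 'a \<Rightarrow> 'f" where
  "coef l d a y = (SOME p. \<exists>u v. y = p *s a + u + v \<and> u \<in> null_space a \<and> v \<in> eigenspace a l d)"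

definition odd_part :: "'f \<Rightarrow> 'f \<Rightarrow> 'a \<Rightarrow> 'a \<Rightarrow> 'a" where
  "odd_part l d a y = (SOME v. \<exists>p u. y = p *s a + u + v \<and> u \<in> null_space a \<and> v \<in> eigenspace a l d)"

definition null_part :: "'f \<Rightarrow> 'f \<Rightarrow> 'a \<Rightarrow> 'a \<Rightarrow> 'a" where
  "null_part l d a y = y - coef l d a y *s a - odd_part l d a y"

text \<open>Left multiplication by \<open>a\<close> acts on the three summands by the distinct
  scalars 1, 0 and \<open>l\<close>. Applying it twice isolates \<open>v\<close>.\<close>

lemma axis_independent:
  assumes "axis l d a" "u \<in> null_space a" "v \<in> eigenspace a l d" "p *s a + u + v = 0"
  shows "p = 0" "u = 0" "v = 0"
proof -
  have ax: "l \<noteq> 0" "l \<noteq> 1" "a \<noteq> 0" "a \<cdot> a = a" "a \<cdot> u = 0" "a \<cdot> v = l *s v"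
    using assms by (auto simp: axis_def null_space_def eigenspace_def)
  have 1: "p *s a + l *s v = 0"
    using arg_cong[OF assms(4), of "\<lambda>x. a \<cdot> x"] ax by simp
  have 2: "p *s a + l *s (l *s v) = 0"
    using arg_cong[OF 1, of "\<lambda>x. a \<cdot> x"] ax by simp
  from 1 2 have "l *s v = l *s (l *s v)"
    by (metis add_left_cancel)
  then have "(l - l * l) *s v = 0" by (simp add: scale_left_diff_distrib)
  moreover have "l - l * l \<noteq> 0" using ax by simp
  ultimately show v: "v = 0" by simp
  show p: "p = 0" using 1 v ax by simp
  show "u = 0" using assms(4) v p by simp
qed

lemma axis_unique:
  assumes ax: "axis l d a"
    and mem: "u \<in> null_space a" "v \<in> eigenspace a l d" "u' \<in> null_space a" "v' \<in> eigenspace a l d"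
    and eq: "p *s a + u + v = p' *s a + u' + v'"
  shows "p = p'" "u = u'" "v = v'"
proof -
  have "(p - p') *s a + (u - u') + (v - v') = 0"
    using eq by (simp add: scale_left_diff_distrib algebra_simps)
  moreover have "u - u' \<in> null_space a" "v - v' \<in> eigenspace a l d"
    using mem subspace_null_space subspace_eigenspace by (auto intro: subspace_diff)
  ultimately show "p = p'" "u = u'" "v = v'"
    using axis_independent[OF ax] by (metis eq_iff_diff_eq_0)+
qed

lemma components_eqI:
  assumes ax: "axis l d a" and u: "u \<in> null_space a" and v: "v \<in> eigenspace a l d"
    and y: "y = p *s a + u + v"
  shows "coef l d a y = p" "odd_part l d a y = v" "null_part l d a y = u"
proof -
  show c: "coef l d a y = p" unfolding coef_def
  proof (rule some_equality)
    show "\<exists>u v. y = p *s a + u + v \<and> u \<in> null_space a \<and> v \<in> eigenspace a l d"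
      using assms by blast
  qed (use axis_unique[OF ax _ _ u v] y in blast)
  show o: "odd_part l d a y = v" unfolding odd_part_def
  proof (rule some_equality)
    show "\<exists>p u. y = p *s a + u + v \<and> u \<in> null_space a \<and> v \<in> eigenspace a l d"
      using assms by blast
  qed (use axis_unique[OF ax _ _ u v] y in blast)
  show "null_part l d a y = u" unfolding null_part_def c o by (simp add: y)
qed

lemma components:
  assumes ax: "axis l d a"
  shows "y = coef l d a y *s a + null_part l d a y + odd_part l d a y"
    and "null_part l d a y \<in> null_space a" and "odd_part l d a y \<in> eigenspace a l d"
proof -
  obtain p u v where *: "y = p *s a + u + v" "u \<in> null_space a" "v \<in> eigenspace a l d"
    using ax unfolding axis_def by blast
  from components_eqI[OF ax *(2,3,1)] *
  show "y = coef l d a y *s a + null_part l d a y + odd_part l d a y"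
    and "null_part l d a y \<in> null_space a" and "odd_part l d a y \<in> eigenspace a l d"
    by simp_all
qed

lemma axis_mult:
  assumes ax: "axis l d a"
  shows "a \<cdot> a = a" "a \<cdot> null_part l d a y = 0" "null_part l d a y \<cdot> a = 0"
    "a \<cdot> odd_part l d a y = l *s odd_part l d a y" "odd_part l d a y \<cdot> a = d *s odd_part l d a y"
    "a \<cdot> y = coef l d a y *s a + l *s odd_part l d a y"
    "y \<cdot> a = coef l d a y *s a + d *s odd_part l d a y"
proof -
  show 1: "a \<cdot> a = a" using ax by (simp add: axis_def)
  show 2: "a \<cdot> null_part l d a y = 0" "null_part l d a y \<cdot> a = 0"
    "a \<cdot> odd_part l d a y = l *s odd_part l d a y" "odd_part l d a y \<cdot> a = d *s odd_part l d a y"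
    using components(2,3)[OF ax, of y] by (auto simp: null_space_def eigenspace_def)
  show "a \<cdot> y = coef l d a y *s a + l *s odd_part l d a y"
    by (subst components(1)[OF ax, of y]) (simp add: 1 2)
  show "y \<cdot> a = coef l d a y *s a + d *s odd_part l d a y"
    by (subst components(1)[OF ax, of y]) (simp add: 1 2)
qed

lemma zero_mem [simp]: "0 \<in> null_space a" "0 \<in> eigenspace a l d"
  by (auto simp: null_space_def eigenspace_def)

lemma components_add:
  assumes ax: "axis l d a"
  shows "coef l d a (x + y) = coef l d a x + coef l d a y"
    "odd_part l d a (x + y) = odd_part l d a x + odd_part l d a y"
    "null_part l d a (x + y) = null_part l d a x + null_part l d a y"
proof -
  have "x + y = (coef l d a x + coef l d a y) *s a
      + (null_part l d a x + null_part l d a y) + (odd_part l d a x + odd_part l d a y)"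
    by (subst (1) components(1)[OF ax, of x], subst (1) components(1)[OF ax, of y])
      (simp add: scale_left_distrib algebra_simps)
  from components_eqI[OF ax _ _ this] components(2,3)[OF ax] subspace_null_space subspace_eigenspace
  show "coef l d a (x + y) = coef l d a x + coef l d a y"
    "odd_part l d a (x + y) = odd_part l d a x + odd_part l d a y"
    "null_part l d a (x + y) = null_part l d a x + null_part l d a y"
    by (simp_all add: subspace_add)
qed

lemma components_scale:
  assumes ax: "axis l d a"
  shows "coef l d a (c *s x) = c * coef l d a x"
    "odd_part l d a (c *s x) = c *s odd_part l d a x"
    "null_part l d a (c *s x) = c *s null_part l d a x"
proof -
  have "c *s x = (c * coef l d a x) *s a + c *s null_part l d a x + c *s odd_part l d a x"
    by (subst (1) components(1)[OF ax, of x]) (simp add: scale_right_distrib)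
  from components_eqI[OF ax _ _ this] components(2,3)[OF ax] subspace_null_space subspace_eigenspace
  show "coef l d a (c *s x) = c * coef l d a x"
    "odd_part l d a (c *s x) = c *s odd_part l d a x"
    "null_part l d a (c *s x) = c *s null_part l d a x"
    by (simp_all add: subspace_scale)
qed

lemma components_zero:
  assumes ax: "axis l d a"
  shows "coef l d a 0 = 0" "odd_part l d a 0 = 0" "null_part l d a 0 = 0"
  using components_scale[OF ax, of 0 0] by simp_all

lemma components_diff:
  assumes ax: "axis l d a"
  shows "coef l d a (x - y) = coef l d a x - coef l d a y"
    "odd_part l d a (x - y) = odd_part l d a x - odd_part l d a y"
    "null_part l d a (x - y) = null_part l d a x - null_part l d a y"
  using components_add[OF ax, of x "-1 *s y"] unfolding components_scale[OF ax] by simp_all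

lemma components_axis:
  assumes ax: "axis l d a"
  shows "coef l d a a = 1" "odd_part l d a a = 0" "null_part l d a a = 0"
  using components_eqI[OF ax zero_mem(1) zero_mem(2), of a 1] by simp_all

lemma components_eigenvector:
  assumes ax: "axis l d a" and v: "v \<in> eigenspace a l d"
  shows "coef l d a v = 0" "odd_part l d a v = v" "null_part l d a v = 0"
  using components_eqI[OF ax zero_mem(1) v, of v 0] by simp_all

lemma components_null_vector:
  assumes ax: "axis l d a" and u: "u \<in> null_space a"
  shows "coef l d a u = 0" "odd_part l d a u = 0" "null_part l d a u = u"
  using components_eqI[OF ax u zero_mem(2), of u 0] by simp_all

lemmas components_linear = components_add components_scale components_diff components_zero
  components_axis components_eigenvector components_null_vector

lemma even_space_iff_odd:
  assumes ax: "axis l d a"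
  shows "x \<in> even_space a \<longleftrightarrow> odd_part l d a x = 0"
proof
  assume "x \<in> even_space a"
  then obtain p u where "x = p *s a + u" "u \<in> null_space a" by (auto simp: even_space_iff)
  then show "odd_part l d a x = 0" using components_linear[OF ax] by simp
next
  assume "odd_part l d a x = 0"
  then show "x \<in> even_space a" using components[OF ax, of x] by (auto simp: even_space_iff)
qed

lemma even_odd_eq_0:
  assumes "axis l d a" "x \<in> even_space a" "x \<in> eigenspace a l d"
  shows "x = 0"
  using assms even_space_iff_odd components_eigenvector(2) by metis

lemma null_mem_even: "u \<in> null_space a \<Longrightarrow> u \<in> even_space a"
  unfolding even_space_iff by (rule exI[of _ 0], rule exI[of _ u]) simp

lemma fusion:
  assumes "axis l d a"
  shows "x \<in> even_space a \<Longrightarrow> y \<in> even_space a \<Longrightarrow> x \<cdot> y \<in> even_space a"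
    "x \<in> even_space a \<Longrightarrow> v \<in> eigenspace a l d \<Longrightarrow> x \<cdot> v \<in> eigenspace a l d"
    "v \<in> eigenspace a l d \<Longrightarrow> x \<in> even_space a \<Longrightarrow> v \<cdot> x \<in> eigenspace a l d"
    "v \<in> eigenspace a l d \<Longrightarrow> w \<in> eigenspace a l d \<Longrightarrow> v \<cdot> w \<in> even_space a"
  using assms by (auto simp: axis_def z2_graded_mult_def)

lemma scale_two: "2 *s x = x + x"
  using scale_left_distrib[of 1 1 x] by simp

section \<open>The reflection of an axis is an automorphism\<close>

text \<open>The Miyamoto involution of the axis: it fixes the even part and negates the odd
  part.\<close>

definition refl :: "'f \<Rightarrow> 'f \<Rightarrow> 'a \<Rightarrow> 'a \<Rightarrow> 'a" where
  "refl l d a y = y - 2 *s odd_part l d a y"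

lemma refl_linear:
  assumes ax: "axis l d a"
  shows "refl l d a (x + y) = refl l d a x + refl l d a y"
    "refl l d a (c *s x) = c *s refl l d a x"
    "refl l d a (refl l d a x) = x"
proof -
  show "refl l d a (x + y) = refl l d a x + refl l d a y"
    by (simp add: refl_def components_add[OF ax] scale_right_distrib)
  show "refl l d a (c *s x) = c *s refl l d a x"
    by (simp add: refl_def components_scale[OF ax] scale_right_diff_distrib scale_left_commute)
  have "odd_part l d a (odd_part l d a x) = odd_part l d a x"
    by (rule components_eigenvector(2)[OF ax components(3)[OF ax]])
  then show "refl l d a (refl l d a x) = x"
    unfolding refl_def components_diff[OF ax] components_add[OF ax] scale_two by simp
qed

text \<open>Split the factors as \<open>e + v\<close> and \<open>f + w\<close> into even and odd
  parts. By the grading the odd part of the product is \<open>e \<cdot> w + v \<cdot> f\<close>,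
  which is exactly what changes sign when \<open>v\<close> and \<open>w\<close> do.\<close>

lemma refl_mult:
  assumes ax: "axis l d a"
  shows "refl l d a (x \<cdot> y) = refl l d a x \<cdot> refl l d a y"
proof -
  have ev: "\<exists>e. e \<in> even_space a \<and> x = e + odd_part l d a x" for x
    using components[OF ax, of x] even_space_iff by metis
  obtain e f where e: "e \<in> even_space a" "x = e + odd_part l d a x"
    and f: "f \<in> even_space a" "y = f + odd_part l d a y"
    using ev by meson
  define v w where "v = odd_part l d a x" and "w = odd_part l d a y"
  have v: "v \<in> eigenspace a l d" and w: "w \<in> eigenspace a l d"
    using components(3)[OF ax] by (auto simp: v_def w_def)
  have xy: "x = e + v" "y = f + w" using e f by (simp_all add: v_def w_def)
  have "odd_part l d a (e \<cdot> f) = 0" "odd_part l d a (v \<cdot> w) = 0"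
    "odd_part l d a (e \<cdot> w) = e \<cdot> w" "odd_part l d a (v \<cdot> f) = v \<cdot> f"
    using fusion[OF ax] e(1) f(1) v w components_eigenvector(2)[OF ax]
    by (auto simp flip: even_space_iff_odd[OF ax])
  then have 1: "odd_part l d a (x \<cdot> y) = e \<cdot> w + v \<cdot> f"
    by (simp add: xy components_add[OF ax])
  show ?thesis
    unfolding refl_def 1 scale_two v_def[symmetric] w_def[symmetric] by (simp add: xy)
qed

lemma axis_refl:
  assumes ax: "axis l d a" and bx: "axis m k b"
  shows "axis m k (refl l d a b)"
proof -
  define f where "f = refl l d a"
  have add: "f (x + y) = f x + f y" and sc: "f (c *s x) = c *s f x" and inv: "f (f x) = x"
    and mul: "f (x \<cdot> y) = f x \<cdot> f y" for x y c
    using refl_linear[OF ax] refl_mult[OF ax] by (auto simp: f_def)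
  have zero: "f 0 = 0" using sc[of 0 0] by simp
  \<comment> \<open>As \<open>f\<close> is a multiplicative involution, membership in a space
    attached to \<open>f b\<close> can be tested at \<open>b\<close> after applying
    \<open>f\<close>.\<close>
  have null: "x \<in> null_space (f b) \<longleftrightarrow> f x \<in> null_space b" for x
    unfolding null_space_def mem_Collect_eq by (metis mul inv zero)
  have eig: "x \<in> eigenspace (f b) m k \<longleftrightarrow> f x \<in> eigenspace b m k" for x
    unfolding eigenspace_def mem_Collect_eq by (metis mul inv sc)
  have ev: "x \<in> even_space (f b) \<longleftrightarrow> f x \<in> even_space b" for x
    unfolding even_space_iff by (metis null add sc inv)
  have dec: "\<exists>p u v. y = p *s f b + u + v \<and> u \<in> null_space (f b) \<and> v \<in> eigenspace (f b) m k" for y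
  proof -
    note c = components[OF bx, of "f y"]
    have "y = coef m k b (f y) *s f b + f (null_part m k b (f y)) + f (odd_part m k b (f y))"
      using arg_cong[OF c(1), of f] by (simp only: inv add sc)
    moreover have "f (null_part m k b (f y)) \<in> null_space (f b)" "f (odd_part m k b (f y)) \<in> eigenspace (f b) m k"
      using c(2,3) by (simp_all add: null eig inv)
    ultimately show ?thesis by blast
  qed
  have gr: "z2_graded_mult (even_space (f b)) (eigenspace (f b) m k)"
    unfolding z2_graded_mult_def ev eig mul using fusion[OF bx]
    by (auto simp: ev eig mul)
  have "f b \<noteq> 0" using bx inv zero unfolding axis_def by metis
  moreover have "f b \<cdot> f b = f b" using bx mul unfolding axis_def by metis
  ultimately show ?thesis using bx dec gr unfolding axis_def f_def[symmetric] by blast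
qed

section \<open>Axes that do not commute with everything, and pairs of them\<close>

text \<open>Since \<open>a \<cdot> y - y \<cdot> a\<close> is \<open>l - d\<close> times the odd
  part of \<open>y\<close>, this forces \<open>l \<noteq> d\<close> and a nonzero odd space.\<close>

definition nc_axis :: "'f \<Rightarrow> 'f \<Rightarrow> 'a \<Rightarrow> bool" where
  "nc_axis l d a \<longleftrightarrow> axis l d a \<and> (\<exists>y. a \<cdot> y \<noteq> y \<cdot> a)"

lemma nc_axis_refl:
  assumes ax: "axis l d a" and bx: "nc_axis m k b"
  shows "nc_axis m k (refl l d a b)"
proof -
  obtain y where "b \<cdot> y \<noteq> y \<cdot> b" using bx by (auto simp: nc_axis_def)
  then have "refl l d a b \<cdot> refl l d a y \<noteq> refl l d a y \<cdot> refl l d a b"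
    using refl_mult[OF ax] refl_linear(3)[OF ax] by metis
  then show ?thesis using bx axis_refl[OF ax] by (auto simp: nc_axis_def)
qed

lemma subspace_equalizer:
  fixes f g :: "'a \<Rightarrow> 'a"
  assumes f: "\<And>x y. f (x + y) = f x + f y" "\<And>c x. f (c *s x) = c *s f x"
    and g: "\<And>x y. g (x + y) = g x + g y" "\<And>c x. g (c *s x) = c *s g x"
  shows "subspace {x. f x = g x}"
proof -
  have "f 0 = g 0" using f(2)[of 0 0] g(2)[of 0 0] by simp
  then show ?thesis by (simp add: subspace_def f g)
qed

text \<open>Write \<open>b = u + v\<close>. Since \<open>b \<cdot> v = m *s v\<close>, the square
  \<open>v \<cdot> v\<close> is odd for \<open>a\<close> as well as even, hence 0. Then
  \<open>u \<cdot> v = m *s v\<close> and \<open>v \<cdot> u = k *s v\<close>, and the odd part of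
  \<open>b \<cdot> b = b\<close> reads \<open>(m + k) *s v = v\<close>.\<close>

lemma coef_zero_type:
  assumes ax: "axis l d a" and bx: "axis m k b"
    and c0: "coef l d a b = 0" and v0: "odd_part l d a b \<noteq> 0"
    and vb: "odd_part l d a b \<in> eigenspace b m k"
  shows "m + k = 1"
proof -
  define v u where "v = odd_part l d a b" and "u = null_part l d a b"
  have b: "b = u + v" using components(1)[OF ax, of b] c0 by (simp add: v_def u_def)
  have v: "v \<in> eigenspace a l d" and u: "u \<in> null_space a"
    using components[OF ax] by (auto simp: v_def u_def)
  have bv: "b \<cdot> v = m *s v" "v \<cdot> b = k *s v"
    using vb by (auto simp: eigenspace_def v_def)
  note fus = fusion[OF ax] null_mem_even[OF u] v
  have "v \<cdot> v = m *s v - u \<cdot> v" using bv(1) b by (simp add: algebra_simps)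
  moreover have "m *s v - u \<cdot> v \<in> eigenspace a l d"
    using fus by (intro subspace_diff subspace_scale subspace_eigenspace) auto
  ultimately have vv: "v \<cdot> v = 0"
    using even_odd_eq_0[OF ax, of "v \<cdot> v"] fusion(4)[OF ax v v] by simp
  have uv: "u \<cdot> v = m *s v" "v \<cdot> u = k *s v" using bv vv by (simp_all add: b)
  have "b \<cdot> b = b" using axis_mult(1)[OF bx] .
  then have "u \<cdot> u + (m + k) *s v = u + v"
    by (simp add: b uv vv scale_left_distrib algebra_simps)
  then have "odd_part l d a (u \<cdot> u + (m + k) *s v) = odd_part l d a (u + v)" by simp
  moreover have "odd_part l d a (u \<cdot> u) = 0"
    using fus by (simp flip: even_space_iff_odd[OF ax])
  ultimately have "(m + k) *s v = 1 *s v"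
    using u v by (simp add: components_linear[OF ax])
  then show ?thesis using v0 by (simp only: scale_right_imp_eq v_def scale_cancel_right) simp
qed

text \<open>A nonzero odd vector of type \<open>(l, d)\<close> is decomposed with respect to type
  \<open>(m, k)\<close>. As \<open>l\<close> is neither 0 nor 1, only its odd component survives,
  and comparing eigenvalues on it gives the claim.\<close>

lemma nc_axis_type_unique:
  assumes "nc_axis l d a" "nc_axis m k a"
  shows "l = m" "d = k"
proof -
  have ax: "axis l d a" and bx: "axis m k a" using assms by (auto simp: nc_axis_def)
  obtain y where y: "a \<cdot> y \<noteq> y \<cdot> a" using assms by (auto simp: nc_axis_def)
  define v where "v = odd_part l d a y"
  have v0: "v \<noteq> 0" using y axis_mult(6,7)[OF ax, of y] by (auto simp: v_def)
  have av: "a \<cdot> v = l *s v" "v \<cdot> a = d *s v" using axis_mult[OF ax] by (auto simp: v_def)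
  define p u w where "p = coef m k a v" and "u = null_part m k a v" and "w = odd_part m k a v"
  have dec: "v = p *s a + u + w" using components(1)[OF bx] by (simp add: p_def u_def w_def)
  have u: "u \<in> null_space a" and w: "w \<in> eigenspace a m k"
    using components(2,3)[OF bx] by (auto simp: u_def w_def)
  have 1: "l *s w = m *s w" "d *s w = k *s w" "l * p = p" "l *s u = 0"
    using arg_cong[OF av(1), of "odd_part m k a"] arg_cong[OF av(2), of "odd_part m k a"]
      arg_cong[OF av(1), of "coef m k a"] arg_cong[OF av(1), of "null_part m k a"]
    unfolding axis_mult(6,7)[OF bx, of v]
    using components(2,3)[OF bx, of v]
    by (auto simp: components_linear[OF bx] p_def u_def w_def)
  have "l \<noteq> 0" "l \<noteq> 1" using ax by (auto simp: axis_def)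
  then have "p = 0" "u = 0" using 1(3,4) by auto
  then have "w \<noteq> 0" using dec v0 by simp
  then show "l = m" "d = k" using 1(1,2) by auto
qed

text \<open>Equality of \<open>a\<close> and \<open>b\<close> belongs to the first case, which is why \<open>l + d = 1\<close> is not claimed
  there unconditionally.\<close>

lemma nc_axis_pair:
  assumes anc: "nc_axis l d a" and bnc: "nc_axis m k b"
  obtains
    (same_type) "m = l" "k = d" "coef l d a b = 1" "odd_part l d a b = b - a"
      "odd_part l d a b = 0 \<or> l + d = 1"
  | (orthogonal) "a \<cdot> b = 0" "b \<cdot> a = 0" "coef l d a b = 0" "odd_part l d a b = 0"
  | (opposite_type) "m = d" "k = l" "l + d = 1" "coef l d a b = 0"
      "odd_part m k b a = odd_part l d a b"
proof -
  have ax: "axis l d a" and bx: "axis m k b" using assms by (auto simp: nc_axis_def)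
  have ld: "l \<noteq> d" using anc axis_mult(6,7)[OF ax] by (auto simp: nc_axis_def)
  have mk: "m \<noteq> k" using bnc axis_mult(6,7)[OF bx] by (auto simp: nc_axis_def)
  define p v q w where "p = coef l d a b" and "v = odd_part l d a b"
    and "q = coef m k b a" and "w = odd_part m k b a"
  have v: "v \<in> eigenspace a l d" and w: "w \<in> eigenspace b m k"
    using components(3)[OF ax] components(3)[OF bx] by (auto simp: v_def w_def)
  have ab1: "a \<cdot> b = p *s a + l *s v" and ba1: "b \<cdot> a = p *s a + d *s v"
    using axis_mult(6,7)[OF ax, of b] by (auto simp: p_def v_def)
  have ba2: "b \<cdot> a = q *s b + m *s w" and ab2: "a \<cdot> b = q *s b + k *s w"
    using axis_mult(6,7)[OF bx, of a] by (auto simp: q_def w_def)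
  \<comment> \<open>Both sides equal \<open>a \<cdot> b - b \<cdot> a\<close>, so the two odd parts
    are proportional.\<close>
  have "(l - d) *s v = (k - m) *s w"
    using ab1 ba1 ab2 ba2 by (simp add: scale_left_diff_distrib)
      (metis add_diff_cancel_left)
  then have "(1 / (l - d)) *s ((l - d) *s v) = (1 / (l - d)) *s ((k - m) *s w)"
    "(1 / (k - m)) *s ((k - m) *s w) = (1 / (k - m)) *s ((l - d) *s v)"
    by simp_all
  then have vw: "v = ((k - m) / (l - d)) *s w" and wv: "w = ((l - d) / (k - m)) *s v"
    using ld mk by simp_all
  define r where "r = (l - d) / (k - m)"
  have r0: "r \<noteq> 0" using ld mk by (simp add: r_def)
  have wr: "w = r *s v" using wv by (simp add: r_def)
  have vr: "v = (1 / r) *s w" using vw by (simp add: r_def)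
  show ?thesis
  proof (cases "v = 0")
    case True
    then have w0: "w = 0" using wr by simp
    \<comment> \<open>Without odd parts, either both products vanish or \<open>a\<close> and
      \<open>b\<close> are proportional idempotents, hence equal.\<close>
    have eq: "p *s a = q *s b" using ab1 ab2 True w0 by simp
    have ne: "a \<noteq> 0" "b \<noteq> 0" using ax bx by (auto simp: axis_def)
    show ?thesis
    proof (cases "p = 0")
      case True
      then have "a \<cdot> b = 0" "b \<cdot> a = 0" using ab1 ba1 \<open>v = 0\<close> by auto
      then show ?thesis using orthogonal True \<open>v = 0\<close> by (auto simp: p_def v_def)
    next
      case False
      then have q: "q \<noteq> 0" using eq ne by auto
      define s where "s = q / p"
      have "s \<noteq> 0" using q False by (simp add: s_def)
      have as: "a = s *s b"
      proof -
        have "(1 / p) *s (p *s a) = (1 / p) *s (q *s b)" using eq by simp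
        then show ?thesis using False by (simp add: s_def)
      qed
      have "s *s (s *s b) = a \<cdot> a"
        by (simp only: as mult_scale_left mult_scale_right axis_mult(1)[OF bx])
      also have "\<dots> = s *s b" by (simp only: axis_mult(1)[OF ax]) (rule as)
      finally have "s *s (s *s b) = s *s b" .
      then have "s = 1" using ne \<open>s \<noteq> 0\<close> by auto
      then have "b = a" using as by simp
      moreover have "m = l" "k = d" using nc_axis_type_unique anc bnc \<open>b = a\<close> by auto
      ultimately show ?thesis
        using same_type components_axis[OF ax] \<open>v = 0\<close> by (simp add: v_def)
    qed
  next
    case False
    then have w0: "w \<noteq> 0" using wr r0 by simp
    have odd: "odd_part l d a v = v" "coef l d a v = 0" "null_part l d a v = 0"
      using components_eigenvector[OF ax v] by auto
    have odd': "odd_part m k b w = w" "coef m k b w = 0" "null_part m k b w = 0"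
      using components_eigenvector[OF bx w] by auto
    \<comment> \<open>The two expansions of each product are compared component by component. The
      components along \<open>a\<close> and along \<open>b\<close> give \<open>p = q * p\<close> and
      \<open>q = p * q\<close>, so \<open>p = q\<close> is 0 or 1.\<close>
    have e1: "p *s a + l *s v = q *s b + (k * r) *s v"
      using trans[OF ab1[symmetric] ab2] by (simp only: wr scale_scale)
    have e2: "p *s a + d *s v = q *s b + (m * r) *s v"
      using trans[OF ba1[symmetric] ba2] by (simp only: wr scale_scale)
    have e3: "q *s b + k *s w = p *s a + (l / r) *s w"
      using trans[OF ab2[symmetric] ab1] by (simp only: vr scale_scale times_divide_eq_right mult_1_right)
    have f1: "q *s null_part l d a b = 0"
      using arg_cong[OF e1, of "null_part l d a"] odd
      by (simp add: components_linear[OF ax])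
    have f2: "p = q * p" "l = q + k * r"
      using arg_cong[OF e1, of "coef l d a"] arg_cong[OF e1, of "odd_part l d a"] odd False
      by (simp_all add: components_linear[OF ax] flip: p_def v_def scale_left_distrib)
    have f3: "d = q + m * r"
      using arg_cong[OF e2, of "odd_part l d a"] odd False
      by (simp_all add: components_linear[OF ax] flip: p_def v_def scale_left_distrib)
    have f4: "q = p * q" "k = p + l / r"
      using arg_cong[OF e3, of "coef m k b"] arg_cong[OF e3, of "odd_part m k b"] odd' w0
      by (simp_all add: components_linear[OF bx] flip: q_def w_def scale_left_distrib)
    have pq: "p = q" using f2(1) f4(1) by (metis mult.commute)
    then have "p * (p - 1) = 0" using f2(1) by (simp add: right_diff_distrib)
    then have p01: "p = 0 \<or> p = 1" by simp
    have rel: "l = p + k * r" "d = p + m * r" "p *s null_part l d a b = 0"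
      using f1 f2(2) f3 pq by (simp_all only:)
    show ?thesis
    proof (cases "p = 1")
      case True
      then have bv: "b = a + v"
        using rel(3) components(1)[OF ax, of b] by (simp add: p_def v_def)
      have "b \<cdot> b = b" using axis_mult(1)[OF bx] .
      \<comment> \<open>The left side is even and the right side odd, so both vanish; this yields
        \<open>l + d = 1\<close>.\<close>
      then have "v \<cdot> v = v - (l + d) *s v"
        using axis_mult(1)[OF ax] axis_mult(4,5)[OF ax, of b, folded v_def]
        by (simp add: bv scale_left_distrib algebra_simps)
      moreover have "v - (l + d) *s v \<in> eigenspace a l d"
        by (intro subspace_diff subspace_scale subspace_eigenspace v)
      ultimately have "v \<cdot> v = 0"
        using even_odd_eq_0[OF ax, of "v \<cdot> v"] fusion(4)[OF ax v v] by simp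
      then have "(l + d) *s v = 1 *s v" using \<open>v \<cdot> v = v - (l + d) *s v\<close> by simp
      then have ld1: "l + d = 1" using False by (simp only: scale_cancel_right) simp
      have "k * r = r + l" using f4(2) True r0 by (simp add: field_simps)
      then have "r = - 1" using rel(1) True by (simp add: algebra_simps eq_neg_iff_add_eq_0)
      then have "l = 1 - k" "d = 1 - m" using rel(1,2) True by auto
      then have "m = l" "k = d"
        using ld1 by (metis add.commute add_left_cancel diff_add_cancel)+
      moreover have "odd_part l d a b = b - a"
        using bv by (metis v_def add_diff_cancel_left')
      ultimately show ?thesis using same_type True ld1 unfolding p_def by blast
    next
      case False
      then have p0: "p = 0" using p01 by simp
      \<comment> \<open>By proportionality each odd part is odd for both axes, so
        \<open>coef_zero_type\<close> applies in both directions and then forces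
        \<open>r = 1\<close>.\<close>
      have vb: "v \<in> eigenspace b m k" and wa: "w \<in> eigenspace a l d"
        using vr w wr v subspace_scale[OF subspace_eigenspace] by metis+
      have "m + k = 1"
        using coef_zero_type[OF ax bx] vb p0 \<open>v \<noteq> 0\<close> by (simp add: p_def v_def)
      moreover have "l + d = 1"
        using coef_zero_type[OF bx ax] wa p0 w0 pq by (simp add: q_def w_def)
      moreover have "l + d = (m + k) * r" using rel(1,2) p0 by (simp add: algebra_simps)
      ultimately have r1: "r = 1" by simp
      then have "m = d" "k = l" "w = v" using rel(1,2) p0 wr by simp_all
      then show ?thesis
        using opposite_type p0 \<open>l + d = 1\<close> unfolding p_def v_def w_def by blast
    qed
  qed
qed

lemma nc_axis_axis: "nc_axis l d a \<Longrightarrow> axis l d a"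
  by (simp add: nc_axis_def)

lemma nc_axis_type_neq:
  assumes "nc_axis l d a"
  shows "l \<noteq> d"
  using assms axis_mult(6,7)[of l d a] by (auto simp: nc_axis_def)

lemma nc_axis_commute_odd:
  assumes a: "nc_axis l d a" and b: "a \<cdot> b = b \<cdot> a"
  shows "odd_part l d a b = 0"
  using b axis_mult(6,7)[OF nc_axis_axis[OF a], of b] nc_axis_type_neq[OF a] by simp

text \<open>Commuting with \<open>b\<close> makes \<open>a \<cdot> b\<close> a multiple
  \<open>c *s a\<close>. If \<open>c\<close> were nonzero, the components of \<open>a\<close> with
  respect to \<open>b\<close> would make \<open>a\<close> either odd for \<open>b\<close>, which is
  impossible for a nonzero idempotent, or a multiple of \<open>b\<close>, which would make
  \<open>a\<close> commute with everything.\<close>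

lemma nc_axis_commuting_axis:
  assumes a: "nc_axis l d a" and bx: "axis m k b" and comm: "\<And>y. b \<cdot> y = y \<cdot> b"
  shows "a \<cdot> b = 0"
proof (rule ccontr)
  assume n0: "a \<cdot> b \<noteq> 0"
  have ax: "axis l d a" using nc_axis_axis[OF a] .
  have aa: "a \<cdot> a = a" "a \<noteq> 0" using ax by (auto simp: axis_def)
  have m: "m \<noteq> 1" using bx by (simp add: axis_def)
  define c p u v where "c = coef l d a b" and "p = coef m k b a"
    and "u = null_part m k b a" and "v = odd_part m k b a"
  have dec: "a = p *s b + u + v" using components(1)[OF bx] by (simp add: p_def u_def v_def)
  have v: "v \<in> eigenspace b m k" using components(3)[OF bx] by (simp add: v_def)
  have eq: "a \<cdot> b = c *s a"
    using axis_mult(6)[OF ax, of b] nc_axis_commute_odd[OF a comm[symmetric]] by (simp add: c_def)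
  then have c0: "c \<noteq> 0" using n0 by auto
  have "c *s a = p *s b + m *s v"
    using eq comm[of a] axis_mult(6)[OF bx, of a] by (simp add: p_def v_def)
  from arg_cong[OF this, of "coef m k b"] arg_cong[OF this, of "null_part m k b"]
    arg_cong[OF this, of "odd_part m k b"]
  have 1: "c * p = p" "c *s u = 0" "c *s v = m *s v"
    using v by (auto simp: components_linear[OF bx] p_def u_def v_def)
  then have u0: "u = 0" using c0 by simp
  show False
  proof (cases "p = 0")
    case True
    then have "a \<in> eigenspace b m k" using dec u0 v by simp
    then have "a = 0"
      using fusion(4)[OF bx, of a a] even_odd_eq_0[OF bx, of a] aa by simp
    then show False using aa by simp
  next
    case False
    then have "c = 1" using 1(1) by simp
    then have "v = 0" using 1(3) m scale_cancel_right[of 1 v m] by simp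
    then have "a = p *s b" using dec u0 by simp
    then have "a \<cdot> y = y \<cdot> a" for y using comm by simp
    then show False using a by (simp add: nc_axis_def)
  qed
qed

end

section \<open>Spanning by axes\<close>

locale paj_not_char_2 = paj scale mult
  for scale :: "'f::field \<Rightarrow> 'a::ab_group_add \<Rightarrow> 'a"  (infixr \<open>*s\<close> 75)
    and mult :: "'a \<Rightarrow> 'a \<Rightarrow> 'a"  (infixl \<open>\<cdot>\<close> 70) +
  assumes two_neq_0: "(2::'f) \<noteq> 0"
begin

text \<open>The odd part of an axis \<open>b\<close> with respect to an axis \<open>a\<close> is half the difference of \<open>b\<close> and its
  reflected axis, so the span of the axes is closed under multiplication.\<close>

lemma span_axes: "span {b. \<exists>l d. axis l d b} = UNIV"
proof -
  define S where "S = {b. \<exists>l d. axis l d b}"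
  have ab: "a \<cdot> b \<in> span S" if "a \<in> S" "b \<in> S" for a b
  proof -
    obtain l d where ax: "axis l d a" using \<open>a \<in> S\<close> by (auto simp: S_def)
    have r: "refl l d a b \<in> S" using axis_refl[OF ax] \<open>b \<in> S\<close> unfolding S_def by blast
    have "odd_part l d a b = (1 / 2) *s (b - refl l d a b)"
      using two_neq_0 by (simp add: refl_def)
    then have "odd_part l d a b \<in> span S"
      using r \<open>b \<in> S\<close> by (auto intro: span_scale span_diff span_base)
    then show ?thesis
      using axis_mult(6)[OF ax, of b] \<open>a \<in> S\<close> by (simp add: span_add span_scale span_base)
  qed
  have *: "a \<cdot> y \<in> span S" if "a \<in> S" "y \<in> span S" for a y
    using that(2)
  proof (induction rule: span_induct)
    case base
    show ?case by (auto simp: subspace_def span_add span_scale span_zero)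
  qed (use ab that in auto)
  have "x \<cdot> y \<in> span S" if "x \<in> span S" "y \<in> span S" for x y
    using that(1)
  proof (induction rule: span_induct)
    case base
    show ?case by (auto simp: subspace_def span_add span_scale span_zero)
  qed (use * that in auto)
  then have sub: "subalgebra (span S)" by (simp add: subalgebra_def subspace_span)
  obtain X where X: "\<forall>a\<in>X. \<exists>l d. primitive_axis l d a" "subalgebra hull X = UNIV"
    using generated_by_axes by blast
  have "X \<subseteq> span S"
    using X(1) primitive_axis_imp_axis unfolding S_def by (blast intro: span_base)
  then have "subalgebra hull X \<subseteq> span S" using sub by (rule hull_minimal)
  then show ?thesis using X(2) by (auto simp: S_def)
qed

lemma axes_induct:
  assumes "subspace {x. P x}" and "\<And>l d b. axis l d b \<Longrightarrow> P b"
  shows "P x"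
proof -
  have "x \<in> span {b. \<exists>l d. axis l d b}" by (simp add: span_axes)
  then show ?thesis by (rule span_induct) (use assms in auto)
qed

section \<open>Spanning the odd part by shifts of the axis\<close>

definition shifts :: "'f \<Rightarrow> 'f \<Rightarrow> 'a \<Rightarrow> 'a set" where
  "shifts l d a = {w \<in> eigenspace a l d. nc_axis l d (a + w)}"

text \<open>By linearity \<open>y\<close> may be taken to be an axis. The classification of pairs
  then makes its odd part 0, a shift, or a multiple of a shift.\<close>

lemma odd_part_in_span_shifts:
  assumes a: "nc_axis l d a"
  shows "odd_part l d a y \<in> span (shifts l d a)"
proof (rule axes_induct[of _ y])
  note ax = nc_axis_axis[OF a]
  show "subspace {x. odd_part l d a x \<in> span (shifts l d a)}"
    by (auto simp: subspace_def components_linear[OF ax] span_add span_scale span_zero)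
  fix m k b assume bx: "axis m k b"
  note v = components(3)[OF ax, of b]
  show "odd_part l d a b \<in> span (shifts l d a)"
  proof (cases "\<exists>y. b \<cdot> y \<noteq> y \<cdot> b")
    case True
    then have b: "nc_axis m k b" using bx by (simp add: nc_axis_def)
    from a b show ?thesis
    proof (cases rule: nc_axis_pair)
      case same_type
      then have "odd_part l d a b \<in> shifts l d a" using b v by (simp add: shifts_def)
      then show ?thesis by (rule span_base)
    next
      case orthogonal
      then show ?thesis by (simp add: span_zero)
    next
      case opposite_type
      \<comment> \<open>Here \<open>b\<close> itself is no shift of \<open>a\<close>, but the reflection of \<open>a\<close> along \<open>b\<close> is one.\<close>
      then have "refl m k b a = a + (- 2) *s odd_part l d a b" by (simp add: refl_def)
      then have "nc_axis l d (a + (- 2) *s odd_part l d a b)"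
        using nc_axis_refl[OF bx a] by simp
      then have "(- 2) *s odd_part l d a b \<in> shifts l d a"
        using subspace_scale[OF subspace_eigenspace v] unfolding shifts_def by blast
      then have "(- 1 / 2) *s ((- 2) *s odd_part l d a b) \<in> span (shifts l d a)"
        by (intro span_scale span_base)
      then show ?thesis using two_neq_0 by simp
    qed
  next
    case False
    then show ?thesis using nc_axis_commute_odd[OF a] by (metis span_zero)
  qed
qed

text \<open>Reduces a linear statement about odd vectors to those \<open>w\<close> for which
  \<open>a + w\<close> is an axis, so that the classification of pairs becomes available.\<close>

lemma odd_induct:
  assumes a: "nc_axis l d a" and z: "z \<in> eigenspace a l d"
    and "subspace {x. P x}" and "\<And>w. w \<in> eigenspace a l d \<Longrightarrow> nc_axis l d (a + w) \<Longrightarrow> P w"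
  shows "P z"
proof -
  have "z \<in> span (shifts l d a)"
    using odd_part_in_span_shifts[OF a] components_eigenvector(2)[OF nc_axis_axis[OF a] z] by metis
  then show ?thesis by (rule span_induct) (use assms in \<open>auto simp: shifts_def\<close>)
qed

section \<open>Products of odd and null vectors\<close>

text \<open>By bilinearity \<open>x\<close> and \<open>y\<close> may be taken to be shifts; the pair
  of axes \<open>a + x\<close> and \<open>a + y\<close> is then classified.\<close>

lemma odd_mult_odd:
  assumes a: "nc_axis l d a" and x: "x \<in> eigenspace a l d" and y: "y \<in> eigenspace a l d"
  shows "x \<cdot> y = 0"
proof (rule odd_induct[OF a x])
  show "subspace {x. x \<cdot> y = 0}" by (simp add: subspace_def)
  fix x assume x: "x \<in> eigenspace a l d" "nc_axis l d (a + x)"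
  show "x \<cdot> y = 0"
  proof (rule odd_induct[OF a y])
    show "subspace {y. x \<cdot> y = 0}" by (simp add: subspace_def)
    fix y assume y: "y \<in> eigenspace a l d" "nc_axis l d (a + y)"
    note ax = nc_axis_axis[OF a]
    define b c where "b = a + x" and "c = a + y"
    have b: "nc_axis l d b" and c: "nc_axis l d c" using x y by (auto simp: b_def c_def)
    note bx = nc_axis_axis[OF b]
    have ev: "x \<cdot> y \<in> even_space a" "y \<cdot> x \<in> even_space a"
      using fusion(4)[OF ax] x y by auto
    have exy: "a \<cdot> x = l *s x" "x \<cdot> a = d *s x" "a \<cdot> y = l *s y" "y \<cdot> a = d *s y"
      using x y by (auto simp: eigenspace_def)
    have bc: "b \<cdot> c = a + (l *s y + d *s x) + x \<cdot> y"
      and cb: "c \<cdot> b = a + (l *s x + d *s y) + y \<cdot> x"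
      by (simp_all add: b_def c_def exy axis_mult(1)[OF ax] algebra_simps)
    from b c show "x \<cdot> y = 0"
    proof (cases rule: nc_axis_pair)
      case same_type
      then have "b \<cdot> c = a + x + l *s (y - x)"
        using axis_mult(6)[OF bx, of c] by (simp add: b_def c_def)
      \<comment> \<open>The left side is even and the right side odd.\<close>
      then have "x \<cdot> y = x - l *s x - d *s x"
        unfolding bc by (simp add: algebra_simps)
      moreover have "x - l *s x - d *s x \<in> eigenspace a l d"
        using x by (intro subspace_diff subspace_scale subspace_eigenspace) auto
      ultimately show ?thesis using even_odd_eq_0[OF ax] ev by metis
    next
      case orthogonal
      have "odd_part l d a (x \<cdot> y) = 0" "odd_part l d a (y \<cdot> x) = 0"
        using ev by (simp_all add: even_space_iff_odd[OF ax])
      moreover have "odd_part l d a (b \<cdot> c) = 0" "odd_part l d a (c \<cdot> b) = 0"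
        using orthogonal components_linear[OF ax] by simp_all
      \<comment> \<open>These are the odd parts of the vanishing products. As
        \<open>l \<noteq> d\<close>, their difference gives \<open>x = y\<close>, so the idempotent
        \<open>b\<close> would have square 0.\<close>
      ultimately have "l *s y + d *s x = 0" "l *s x + d *s y = 0"
        using x y unfolding bc cb by (simp_all add: components_linear[OF ax])
      moreover have "(l - d) *s (x - y) = (l *s x + d *s y) - (l *s y + d *s x)"
        by (simp add: scale_left_diff_distrib scale_right_diff_distrib)
      ultimately have "(l - d) *s (x - y) = 0" by simp
      then have "b = c" using nc_axis_type_neq[OF a] by (simp add: b_def c_def)
      then have "b = 0" using orthogonal axis_mult(1)[OF bx] by simp
      then show ?thesis using bx by (simp add: axis_def)
    next
      case opposite_type
      then show ?thesis using nc_axis_type_neq[OF a] by simp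
    qed
  qed
qed

text \<open>Formulated on \<open>z\<close>, not as \<open>l + d = 1\<close>, so as to be linear in
  \<open>z\<close> and to include \<open>z = 0\<close>. For a shift \<open>z\<close>, the component
  of \<open>a + z\<close> along \<open>a\<close> is 1, which leaves only the case
  \<open>same_type\<close>.\<close>

lemma type_sum_scale_odd:
  assumes a: "nc_axis l d a" and z: "z \<in> eigenspace a l d"
  shows "(l + d) *s z = z"
proof (rule odd_induct[OF a z])
  show "subspace {z. (l + d) *s z = z}"
    by (rule subspace_equalizer) (simp_all only: mult_add_left mult_add_right mult_scale_left
      mult_scale_right scale_right_distrib scale_left_commute)
  fix z assume z: "z \<in> eigenspace a l d" "nc_axis l d (a + z)"
  note ax = nc_axis_axis[OF a]
  have 1: "coef l d a (a + z) = 1" "odd_part l d a (a + z) = z"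
    using z by (simp_all add: components_linear[OF ax])
  from a z(2) show "(l + d) *s z = z"
  proof (cases rule: nc_axis_pair)
    case same_type
    then show ?thesis using 1(2) by (metis scale_one scale_zero_right)
  next
    case orthogonal
    then show ?thesis using 1(1) by simp
  next
    case opposite_type
    then show ?thesis using 1(1) by simp
  qed
qed

text \<open>Linearity reduces to axes \<open>a + z\<close> and \<open>b\<close>. If \<open>b\<close>
  is non-commuting and its null part \<open>u\<close> is nonzero, then \<open>b = u + v\<close>. As
  odd products vanish, multiplying \<open>b\<close> by \<open>a + z\<close> produces
  \<open>z \<cdot> u\<close> and \<open>u \<cdot> z\<close> up to multiples of \<open>v\<close>, so
  classifying this pair yields the relation.\<close>

lemma null_mult_odd:
  assumes a: "nc_axis l d a" and z: "z \<in> eigenspace a l d"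
  shows "l *s (null_part l d a y \<cdot> z) = d *s (z \<cdot> null_part l d a y)"
proof (rule odd_induct[OF a z])
  show "subspace {z. l *s (null_part l d a y \<cdot> z) = d *s (z \<cdot> null_part l d a y)}"
    by (rule subspace_equalizer) (simp_all only: mult_add_left mult_add_right mult_scale_left
      mult_scale_right scale_right_distrib scale_left_commute)
  fix z assume z: "z \<in> eigenspace a l d" and c: "nc_axis l d (a + z)"
  note ax = nc_axis_axis[OF a] and cx = nc_axis_axis[OF c]
  have az: "a \<cdot> z = l *s z" "z \<cdot> a = d *s z" using z by (auto simp: eigenspace_def)
  show "l *s (null_part l d a y \<cdot> z) = d *s (z \<cdot> null_part l d a y)"
  proof (rule axes_induct[of _ y])
    show "subspace {y. l *s (null_part l d a y \<cdot> z) = d *s (z \<cdot> null_part l d a y)}"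
      by (rule subspace_equalizer) (simp_all only: components_linear[OF ax] mult_add_left mult_add_right
        mult_scale_left mult_scale_right scale_right_distrib scale_left_commute)
    fix m k b assume bx: "axis m k b"
    define u v where "u = null_part l d a b" and "v = odd_part l d a b"
    have v: "v \<in> eigenspace a l d" using components(3)[OF ax] by (simp add: v_def)
    have av: "a \<cdot> v = l *s v" "v \<cdot> a = d *s v" using v by (auto simp: eigenspace_def)
    have au: "a \<cdot> u = 0" "u \<cdot> a = 0"
      using components(2)[OF ax] by (auto simp: u_def null_space_def)
    have vz: "v \<cdot> z = 0" "z \<cdot> v = 0" using odd_mult_odd[OF a] v z by auto
    have "l *s (u \<cdot> z) = d *s (z \<cdot> u)"
    proof (cases "\<exists>y. b \<cdot> y \<noteq> y \<cdot> b")
      case False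
      then have comm: "\<And>y. b \<cdot> y = y \<cdot> b" by blast
      \<comment> \<open>Both \<open>a\<close> and \<open>a + z\<close> annihilate \<open>b\<close>,
        hence so does \<open>z\<close>.\<close>
      have ab: "a \<cdot> b = 0" and cb: "(a + z) \<cdot> b = 0"
        using nc_axis_commuting_axis[OF a bx comm] nc_axis_commuting_axis[OF c bx comm] by auto
      then have zb: "z \<cdot> b = 0" "b \<cdot> z = 0" using comm by auto
      have "v = 0" using nc_axis_commute_odd[OF a comm[symmetric]] by (simp add: v_def)
      moreover have "coef l d a b = 0"
        using axis_mult(6)[OF ax, of b] ab \<open>v = 0\<close> ax by (auto simp: v_def axis_def)
      ultimately have "u = b" using components(1)[OF ax, of b] by (simp add: u_def v_def)
      then show ?thesis using zb by simp
    next
      case True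
      then have b: "nc_axis m k b" using bx by (simp add: nc_axis_def)
      have "u = 0 \<or> coef l d a b = 0"
        using a b
      proof (cases rule: nc_axis_pair)
        case same_type
        then show ?thesis by (simp add: u_def null_part_def)
      qed auto
      then show ?thesis
      proof
        assume "u = 0"
        then show ?thesis by simp
      next
        assume p0: "coef l d a b = 0"
        then have buv: "b = u + v" using components(1)[OF ax, of b] by (simp add: u_def v_def)
        have cb: "(a + z) \<cdot> b = l *s v + z \<cdot> u" and bc: "b \<cdot> (a + z) = u \<cdot> z + d *s v"
          by (simp_all add: buv av au vz)
        \<comment> \<open>Orthogonal axes make both products 0. For opposite types the products are
          \<open>d *s w\<close> and \<open>l *s w\<close> with the same odd vector \<open>w\<close>
          of \<open>a + z\<close>.\<close>
        from c b have "l *s (b \<cdot> (a + z)) = d *s ((a + z) \<cdot> b)"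
        proof (cases rule: nc_axis_pair)
          case same_type
          have zu: "z \<cdot> u \<in> eigenspace a l d"
            using fusion(3)[OF ax z] null_mem_even components(2)[OF ax] by (auto simp: u_def)
          have "l *s v + z \<cdot> u = (a + z) + l *s (b - (a + z))"
            using axis_mult(6)[OF cx, of b] same_type cb by simp
          \<comment> \<open>The left side is odd, while the right side has component
            \<open>1 - l\<close> along \<open>a\<close>.\<close>
          from arg_cong[OF this, of "coef l d a"] have "1 - l = 0"
            using zu z v p0 by (simp add: components_linear[OF ax])
          then show ?thesis using ax by (simp add: axis_def)
        next
          case opposite_type
          then show ?thesis
            using axis_mult(6,7)[OF cx, of b] by (simp add: mult.commute)
        qed simp
        then have "l *s (u \<cdot> z + d *s v) = d *s (l *s v + z \<cdot> u)" unfolding cb bc .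
        then show ?thesis by (simp add: scale_right_distrib mult.commute)
      qed
    qed
    then show "l *s (null_part l d a b \<cdot> z) = d *s (z \<cdot> null_part l d a b)"
      by (simp add: u_def)
  qed
qed

text \<open>The products \<open>b \<cdot> c\<close> and \<open>c \<cdot> b\<close> differ by a
  multiple of the odd part \<open>u\<close>, so it suffices that \<open>u\<close> has no component
  along \<open>a\<close>.\<close>

lemma coef_commute_nc_axes:
  assumes a: "nc_axis l d a" and b: "nc_axis m k b" and c: "nc_axis m' k' c"
    and b0: "coef l d a b = 0" and c0: "coef l d a c = 0"
  shows "coef l d a (b \<cdot> c) = coef l d a (c \<cdot> b)"
proof -
  note ax = nc_axis_axis[OF a] and bx = nc_axis_axis[OF b] and cx = nc_axis_axis[OF c]
  define u where "u = odd_part m k b c"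
  have u0: "coef l d a u = 0"
    using b c
  proof (cases rule: nc_axis_pair)
    case same_type
    then show ?thesis using u_def b0 c0 by (simp add: components_linear[OF ax])
  next
    case orthogonal
    then show ?thesis by (simp add: u_def components_linear[OF ax])
  next
    case opposite_type
    \<comment> \<open>These are the reflections of \<open>c\<close> along \<open>b\<close> and of
      \<open>b\<close> along \<open>c\<close>. If \<open>u\<close> had a component along
      \<open>a\<close>, so would both of them; both would then have type \<open>(l, d)\<close>, and
      their opposite types would give \<open>l = d\<close>.\<close>
    have "nc_axis m' k' (c - 2 *s u)" "nc_axis m k (b - 2 *s u)"
      using nc_axis_refl[OF bx c] nc_axis_refl[OF cx b] opposite_type
      by (simp_all add: refl_def u_def)
    note nc = this
    have coefs: "coef l d a (c - 2 *s u) = - 2 * coef l d a u"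
      "coef l d a (b - 2 *s u) = - 2 * coef l d a u"
      using b0 c0 by (simp_all add: components_linear[OF ax])
    have "coef l d a (c - 2 *s u) = 0 \<or> m' = l \<and> k' = d"
      using a nc(1) by (cases rule: nc_axis_pair) auto
    moreover have "coef l d a (b - 2 *s u) = 0 \<or> m = l \<and> k = d"
      using a nc(2) by (cases rule: nc_axis_pair) auto
    ultimately show ?thesis
      using coefs opposite_type nc_axis_type_neq[OF a] two_neq_0 by auto
  qed
  then show ?thesis
    using axis_mult(6,7)[OF bx, of c] b0 by (simp add: components_linear[OF ax] flip: u_def)
qed

lemma coef_commute_null:
  assumes a: "nc_axis l d a"
  shows "coef l d a (null_part l d a y \<cdot> null_part l d a z)
    = coef l d a (null_part l d a z \<cdot> null_part l d a y)"
proof (rule axes_induct[of _ y])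
  note ax = nc_axis_axis[OF a]
  show "subspace {y. coef l d a (null_part l d a y \<cdot> null_part l d a z)
    = coef l d a (null_part l d a z \<cdot> null_part l d a y)}"
    by (auto simp: subspace_def components_linear[OF ax])
  fix m k b assume bx: "axis m k b"
  show "coef l d a (null_part l d a b \<cdot> null_part l d a z)
    = coef l d a (null_part l d a z \<cdot> null_part l d a b)"
  proof (rule axes_induct[of _ z])
    show "subspace {z. coef l d a (null_part l d a b \<cdot> null_part l d a z)
      = coef l d a (null_part l d a z \<cdot> null_part l d a b)}"
      by (auto simp: subspace_def components_linear[OF ax])
    fix m' k' c assume cx: "axis m' k' c"
    define u v u' v' where "u = null_part l d a b" and "v = odd_part l d a b"
      and "u' = null_part l d a c" and "v' = odd_part l d a c"
    have v: "v \<in> eigenspace a l d" "v' \<in> eigenspace a l d"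
      using components(3)[OF ax] by (auto simp: v_def v'_def)
    have u: "u \<in> null_space a" "u' \<in> null_space a"
      using components(2)[OF ax] by (auto simp: u_def u'_def)
    then have au: "a \<cdot> u = 0" "u \<cdot> a = 0" "a \<cdot> u' = 0" "u' \<cdot> a = 0"
      by (auto simp: null_space_def)
    \<comment> \<open>A commuting \<open>x\<close> has no odd part, so its null part differs from
      \<open>x\<close> by a multiple of \<open>a\<close>.\<close>
    have comm: "null_part l d a x \<cdot> y = y \<cdot> null_part l d a x"
      if "\<And>y. x \<cdot> y = y \<cdot> x" "a \<cdot> y = 0" "y \<cdot> a = 0" for x y
      using nc_axis_commute_odd[OF a that(1)[symmetric]] that by (simp add: null_part_def)
    have "coef l d a (u \<cdot> u') = coef l d a (u' \<cdot> u)"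
    proof (cases "(\<forall>y. b \<cdot> y = y \<cdot> b) \<or> (\<forall>y. c \<cdot> y = y \<cdot> c)")
      case True
      then have "u \<cdot> u' = u' \<cdot> u"
        using comm[of b u'] comm[of c u] au unfolding u_def u'_def by metis
      then show ?thesis by simp
    next
      case False
      then have b: "nc_axis m k b" and c: "nc_axis m' k' c"
        using bx cx by (auto simp: nc_axis_def)
      have null: "null_part l d a x = 0 \<or> coef l d a x = 0" if "nc_axis i j x" for x i j
        using a that
      proof (cases rule: nc_axis_pair)
        case same_type
        then show ?thesis by (simp add: null_part_def)
      qed auto
      show ?thesis
      proof (cases "u = 0 \<or> u' = 0")
        case False
        then have 0: "coef l d a b = 0" "coef l d a c = 0"
          using null[OF b] null[OF c] by (auto simp: u_def u'_def)
        have buv: "b = u + v" "c = u' + v'"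
          using components(1)[OF ax, of b] components(1)[OF ax, of c] 0
          by (simp_all add: u_def v_def u'_def v'_def)
        have mixed: "coef l d a (x \<cdot> y) = 0" "coef l d a (y \<cdot> x) = 0"
          if "x \<in> null_space a" "y \<in> eigenspace a l d" for x y
          using fusion(2,3)[OF ax] null_mem_even that components_eigenvector(1)[OF ax] by auto
        \<comment> \<open>Mixed products are odd and odd products vanish, so only the null parts
          contribute along \<open>a\<close>.\<close>
        have "coef l d a (b \<cdot> c) = coef l d a (u \<cdot> u')" "coef l d a (c \<cdot> b) = coef l d a (u' \<cdot> u)"
          using odd_mult_odd[OF a] v mixed u
          by (simp_all add: buv components_linear[OF ax])
        then show ?thesis using coef_commute_nc_axes[OF a b c 0] by simp
      qed auto
    qed
    then show "coef l d a (null_part l d a b \<cdot> null_part l d a c)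
      = coef l d a (null_part l d a c \<cdot> null_part l d a b)"
      by (simp add: u_def u'_def)
  qed
qed

section \<open>The flexible law\<close>

lemma flexible_nc_axis:
  assumes a: "nc_axis l d a"
  shows "(a \<cdot> y) \<cdot> z + (z \<cdot> y) \<cdot> a = a \<cdot> (y \<cdot> z) + z \<cdot> (y \<cdot> a)"
proof -
  note ax = nc_axis_axis[OF a]
  define p u v q u' v' where "p = coef l d a y" and "u = null_part l d a y"
    and "v = odd_part l d a y" and "q = coef l d a z" and "u' = null_part l d a z"
    and "v' = odd_part l d a z"
  have y: "y = p *s a + u + v" and z: "z = q *s a + u' + v'"
    using components(1)[OF ax] by (auto simp: p_def u_def v_def q_def u'_def v'_def)
  have v: "v \<in> eigenspace a l d" "v' \<in> eigenspace a l d"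
    using components(3)[OF ax] by (auto simp: v_def v'_def)
  have u: "u \<in> even_space a" "u' \<in> even_space a" "u \<in> null_space a" "u' \<in> null_space a"
    using components(2)[OF ax] null_mem_even by (auto simp: u_def u'_def)
  have av: "a \<cdot> w = l *s w" "w \<cdot> a = d *s w" if "w \<in> eigenspace a l d" for w
    using that by (auto simp: eigenspace_def)
  have au: "a \<cdot> u = 0" "u \<cdot> a = 0" "a \<cdot> u' = 0" "u' \<cdot> a = 0"
    using u by (auto simp: null_space_def)
  have ae: "a \<cdot> x = coef l d a x *s a" "x \<cdot> a = coef l d a x *s a" if "x \<in> even_space a" for x
    using axis_mult(6,7)[OF ax, of x] that by (simp_all add: even_space_iff_odd[OF ax])
  \<comment> \<open>Even products meet \<open>a\<close> only through their component along
    \<open>a\<close>, which is symmetric in \<open>u\<close> and \<open>u'\<close>.\<close>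
  have r: "a \<cdot> (u \<cdot> u') = (u' \<cdot> u) \<cdot> a"
    using ae fusion(1)[OF ax] u coef_commute_null[OF a, of y z] by (simp add: u_def u'_def)
  have uv: "a \<cdot> (u \<cdot> v') = (v' \<cdot> u) \<cdot> a"
    using av fusion(2,3)[OF ax] u v null_mult_odd[OF a v(2), of y] by (simp add: u_def)
  have vu: "a \<cdot> (v \<cdot> u') = l *s (v \<cdot> u')" "(u' \<cdot> v) \<cdot> a = d *s (u' \<cdot> v)"
    using av fusion(2,3)[OF ax] u v by auto
  have vv: "v \<cdot> v' = 0" "v' \<cdot> v = 0" using odd_mult_odd[OF a] v by auto
  \<comment> \<open>Prepares the cancellation of the \<open>v'\<close> terms, whose coefficients are
    \<open>p\<close> times \<open>l\<close>, \<open>d\<close> and their squares.\<close>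
  have "(l - d) *s ((l + d) *s v') = (l - d) *s v'" using type_sum_scale_odd[OF a v(2)] by simp
  then have "(p * (l - d) * (l + d)) *s v' = (p * (l - d)) *s v'"
    by (metis scale_scale)
  then have "(p * l - p * d) *s v' = (p * l * l - p * d * d) *s v'"
    by (simp add: algebra_simps)
  then have p: "(p * l) *s v' - (p * d) *s v' - ((p * l * l) *s v' - (p * d * d) *s v') = 0"
    by (simp add: scale_left_diff_distrib)
  note aa = axis_mult(1)[OF ax]
  have ay: "a \<cdot> y = p *s a + l *s v" and ya: "y \<cdot> a = p *s a + d *s v"
    using axis_mult(6,7)[OF ax] by (simp_all add: p_def v_def)
  note [simp] = aa au vv av(1)[OF v(1)] av(2)[OF v(1)] av(1)[OF v(2)] av(2)[OF v(2)] vu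
  have "(a \<cdot> y) \<cdot> z = (p * q) *s a + (p * l) *s v' + (q * l * d) *s v + l *s (v \<cdot> u')"
    unfolding ay by (simp add: z scale_right_distrib algebra_simps)
  moreover have "z \<cdot> (y \<cdot> a) = (p * q) *s a + (p * d) *s v' + (q * l * d) *s v + d *s (u' \<cdot> v)"
    unfolding ya by (simp add: z scale_right_distrib algebra_simps)
  moreover have "a \<cdot> (y \<cdot> z) = (p * q) *s a + (p * l * l) *s v' + (u' \<cdot> u) \<cdot> a + (v' \<cdot> u) \<cdot> a
      + (q * l * d) *s v + l *s (v \<cdot> u')"
    by (simp add: y z scale_right_distrib r uv algebra_simps)
  moreover have "(z \<cdot> y) \<cdot> a = (p * q) *s a + (p * d * d) *s v' + (u' \<cdot> u) \<cdot> a + (v' \<cdot> u) \<cdot> a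
      + (q * l * d) *s v + d *s (u' \<cdot> v)"
    by (simp add: y z scale_right_distrib algebra_simps)
  \<comment> \<open>All other terms cancel by \<open>r\<close> and \<open>uv\<close>; the remainder
    is the expression that \<open>p\<close> shows to be 0.\<close>
  ultimately have "(a \<cdot> y) \<cdot> z + (z \<cdot> y) \<cdot> a - (a \<cdot> (y \<cdot> z) + z \<cdot> (y \<cdot> a))
      = (p * l) *s v' - (p * d) *s v' - ((p * l * l) *s v' - (p * d * d) *s v')"
    by (simp only:) (simp add: algebra_simps)
  then show ?thesis unfolding p by simp
qed

text \<open>The identity is linear in \<open>x\<close> and \<open>z\<close> and symmetric in them,
  so for two axes it suffices that one is non-commuting. If both commute with everything, reordering
  the factors turns one side into the other.\<close>

lemma flexible_linearized: "(x \<cdot> y) \<cdot> z + (z \<cdot> y) \<cdot> x = x \<cdot> (y \<cdot> z) + z \<cdot> (y \<cdot> x)"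
proof (rule axes_induct[of _ x])
  have sub: "subspace {x. (x \<cdot> y) \<cdot> z + (z \<cdot> y) \<cdot> x = x \<cdot> (y \<cdot> z) + z \<cdot> (y \<cdot> x)}" for y z
    by (rule subspace_equalizer) (simp_all add: scale_right_distrib)
  show "subspace {x. (x \<cdot> y) \<cdot> z + (z \<cdot> y) \<cdot> x = x \<cdot> (y \<cdot> z) + z \<cdot> (y \<cdot> x)}"
    by (rule sub)
  fix l d a assume ax: "axis l d a"
  show "(a \<cdot> y) \<cdot> z + (z \<cdot> y) \<cdot> a = a \<cdot> (y \<cdot> z) + z \<cdot> (y \<cdot> a)"
  proof (rule axes_induct[of _ z])
    show "subspace {z. (a \<cdot> y) \<cdot> z + (z \<cdot> y) \<cdot> a = a \<cdot> (y \<cdot> z) + z \<cdot> (y \<cdot> a)}"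
      using sub[of y a] by (simp add: add.commute)
    fix m k c assume cx: "axis m k c"
    show "(a \<cdot> y) \<cdot> c + (c \<cdot> y) \<cdot> a = a \<cdot> (y \<cdot> c) + c \<cdot> (y \<cdot> a)"
    proof (cases "nc_axis l d a \<or> nc_axis m k c")
      case True
      then show ?thesis
        using flexible_nc_axis[of l d a y c] flexible_nc_axis[of m k c y a]
        by (metis add.commute)
    next
      case False
      then have "\<And>w. a \<cdot> w = w \<cdot> a" "\<And>w. c \<cdot> w = w \<cdot> c"
        using ax cx by (auto simp: nc_axis_def)
      then show ?thesis by (metis add.commute)
    qed
  qed
qed

lemma flexible: "(x \<cdot> y) \<cdot> x = x \<cdot> (y \<cdot> x)"
proof -
  have "2 *s ((x \<cdot> y) \<cdot> x) = 2 *s (x \<cdot> (y \<cdot> x))"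
    using flexible_linearized[of x y x] by (simp only: scale_two)
  then show ?thesis using two_neq_0 by simp
qed

end

theorem theoremE:
  fixes scale :: "'f::field \<Rightarrow> 'a::ab_group_add \<Rightarrow> 'a"
    and mult :: "'a \<Rightarrow> 'a \<Rightarrow> 'a"
  assumes "CHAR('f) \<noteq> 2"
    and "paj scale mult"
  shows "\<forall>x y. mult (mult x y) x = mult x (mult y x)"
proof -
  have "\<not> CHAR('f) dvd 2"
  proof
    assume "CHAR('f) dvd 2"
    \<comment> \<open>A positive divisor of 2 is 1 or 2, and a field never has characteristic
      1.\<close>
    then have "CHAR('f) \<le> 2" "CHAR('f) \<noteq> 0" by (auto dest: dvd_imp_le intro!: Nat.gr0I)
    then show False using assms(1) CHAR_not_1[where ?'a = 'f] by linarith
  qed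
  then have "(2::'f) \<noteq> 0"
    using of_nat_eq_0_iff_char_dvd[where ?'a = 'f and n = 2] by simp
  then interpret paj_not_char_2 scale mult
    using assms(2) by (simp add: paj_not_char_2_def paj_not_char_2_axioms_def)
  show ?thesis using flexible by blast
qed

end
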